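(* A board $\mathfrak{S}$ has no isolated point if and only if $V(\mathfrak{S},\mathbb{Z})$ has maximal rank (namely rank $|\mathfrak{S}|$) in $\mathscr{F}(\mathfrak{S},\mathbb{Z})$.
   Context: A board $\mathfrak{S}$ is a finite subset of $\mathbb{Z}^2$. $\mathscr{F}(\mathfrak{S},\mathbb{Z})$ is the $\mathbb{Z}$-module of integer-valued functions on $\mathfrak{S}$; $[P]$ is the function equal to $1$ at $P$ and $0$ elsewhere. The set of moves $\mathscr{D}(\mathfrak{S})$ consists of all functions $[P]+[Q]-[R]$ with $P,Q,R\in\mathfrak{S}$, $Q=P+v$, $R=P+2v$ for some $v\in\{(\pm1,0),(0,\pm1)\}$; $Q$ is the middle point and $P,R$ the extremities. $V(\mathfrak{S},\mathbb{Z})$ is the $\mathbb{Z}$-span of $\mathscr{D}(\mathfrak{S})$. Two points are neighbors if they are the two extremities of some move; $\equiv$ is the reflexive-transitive closure of this relation. The board has no isolated point if every $P\in\mathfrak{S}$ is $\equiv$-equivalent to the middle point of some move. *)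

theory Defs
  imports "HOL-Library.Function_Algebras" "HOL-Library.Product_Plus" "HOL-Library.Extended_Nat"
begin

type_synonym point = "int \<times> int"

definition directions :: "point set" where
  "directions = {(1, 0), (-1, 0), (0, 1), (0, -1)}"

definition move_triple :: "point set \<Rightarrow> point \<Rightarrow> point \<Rightarrow> point \<Rightarrow> bool" where
  "move_triple S P Q R \<longleftrightarrow>
     P \<in> S \<and> Q \<in> S \<and> R \<in> S \<and> (\<exists>v\<in>directions. Q = P + v \<and> R = P + (v + v))"

text \<open>Functions on a board are represented by functions on the whole grid that vanish
  off the board.\<close>

definition board_funs :: "point set \<Rightarrow> (point \<Rightarrow> int) set" where
  "board_funs S = {f. \<forall>P. P \<notin> S \<longrightarrow> f P = 0}"

definition delta :: "point \<Rightarrow> point \<Rightarrow> int" where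
  "delta P = (\<lambda>X. if X = P then 1 else 0)"

definition moves :: "point set \<Rightarrow> (point \<Rightarrow> int) set" where
  "moves S = {delta P + delta Q - delta R | P Q R. move_triple S P Q R}"

definition int_scale :: "int \<Rightarrow> (point \<Rightarrow> int) \<Rightarrow> (point \<Rightarrow> int)" where
  "int_scale c f = (\<lambda>X. c * f X)"

global_interpretation int_fun: module int_scale
  by unfold_locales (auto simp: int_scale_def fun_eq_iff algebra_simps)

definition move_span :: "point set \<Rightarrow> (point \<Rightarrow> int) set" where
  "move_span S = int_fun.span (moves S)"

text \<open>The rank of a \<open>\<int>\<close>-module is the supremum of the cardinalities of its finite
  \<open>\<int>\<close>-linearly independent subsets. The value is an \<^typ>\<open>enat\<close> so that no finiteness
  has to be presupposed.\<close>

definition int_rank :: "(point \<Rightarrow> int) set \<Rightarrow> enat" where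
  "int_rank M = (SUP B \<in> {B. B \<subseteq> M \<and> finite B \<and> int_fun.independent B}. enat (card B))"

definition neighbors :: "point set \<Rightarrow> point \<Rightarrow> point \<Rightarrow> bool" where
  "neighbors S P R \<longleftrightarrow> (\<exists>Q. move_triple S P Q R)"

definition board_equiv :: "point set \<Rightarrow> point \<Rightarrow> point \<Rightarrow> bool" where
  "board_equiv S = (neighbors S)\<^sup>*\<^sup>*"

definition no_isolated_point :: "point set \<Rightarrow> bool" where
  "no_isolated_point S \<longleftrightarrow>
     (\<forall>P\<in>S. \<exists>A Q B. move_triple S A Q B \<and> board_equiv S P Q)"

end

theory Submission
  imports Defs
begin

text \<open>Adding a move to its reverse gives \<open>2[Q]\<close> for the middle point \<open>Q\<close>, and twice a move then
  gives \<open>2[P] - 2[R]\<close> for neighbours \<open>P\<close>, \<open>R\<close>. Hence, without isolated points, the span contains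
  \<open>2[P]\<close> for every \<open>P\<close> and has full rank. Conversely, if the class \<open>C\<close> of \<open>P\<close> contains no middle
  point, summation over \<open>C\<close> vanishes on all moves but not on \<open>[P]\<close>, so \<open>[P]\<close> can be added to any
  independent subset of the span, which therefore has fewer than \<open>|S|\<close> elements.\<close>

text \<open>Gaussian elimination without division, removing one coordinate of \<open>S\<close> per
  induction step. The vectors form an indexed family rather than a set, because elimination may make
  distinct vectors coincide.\<close>

lemma ex_int_relation_of_card_less:
  fixes v :: "'i \<Rightarrow> 'a \<Rightarrow> int"
  assumes "finite S" "finite I" "card S < card I" "\<And>i X. i \<in> I \<Longrightarrow> X \<notin> S \<Longrightarrow> v i X = 0"
  shows "\<exists>c. (\<exists>i\<in>I. c i \<noteq> 0) \<and> (\<forall>X. (\<Sum>i\<in>I. c i * v i X) = 0)"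
  using assms
proof (induction S arbitrary: I v rule: finite_induct)
  case empty
  then obtain i where "i \<in> I" by fastforce
  with empty show ?case by (intro exI[of _ "\<lambda>_. 1"]) auto
next
  case (insert x S)
  show ?case
  proof (cases "\<forall>i\<in>I. v i x = 0")
    case True
    have "v i X = 0" if "i \<in> I" "X \<notin> S" for i X
      using True that insert.prems(3)[of i X] by (cases "X = x") auto
    moreover have "card S < card I" using insert by simp
    ultimately show ?thesis using insert.IH[of I v] insert.prems(1) by blast
  next
    case False
    then obtain j where j: "j \<in> I" "v j x \<noteq> 0" by blast
    define J where "J = I - {j}"
    \<comment> \<open>Cross-multiplication with the pivot \<open>v j x\<close> makes coordinate
      \<open>x\<close> of every \<open>w i\<close> vanish while staying in the integers.\<close>
    define w where "w i X = v j x * v i X - v i x * v j X" for i X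
    have I: "I = insert j J" "finite J" "j \<notin> J" using j insert.prems by (auto simp: J_def)
    have "card S < card J" using I insert by simp
    moreover have "w i X = 0" if "i \<in> J" "X \<notin> S" for i X
      using that j insert.prems(3)[of i X] insert.prems(3)[of j X]
      by (cases "X = x") (auto simp: w_def J_def)
    ultimately obtain c where c: "\<exists>i\<in>J. c i \<noteq> 0" "\<And>X. (\<Sum>i\<in>J. c i * w i X) = 0"
      using insert.IH[of J w] I(2) by blast
    \<comment> \<open>Expanding each \<open>w i\<close> in the relation for \<open>w\<close> and
      collecting the multiples of \<open>v j\<close> gives these coefficients. Nontriviality
      survives since \<open>v j x\<close> is nonzero.\<close>
    define d where "d i = (if i = j then - (\<Sum>i\<in>J. c i * v i x) else c i * v j x)" for i
    have "(\<Sum>i\<in>I. d i * v i X) = 0" for X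
    proof -
      have "(\<Sum>i\<in>J. d i * v i X) = (\<Sum>i\<in>J. c i * v j x * v i X)"
        using I(3) by (intro sum.cong) (auto simp: d_def)
      then have "(\<Sum>i\<in>I. d i * v i X) = (\<Sum>i\<in>J. c i * w i X)"
        using I by (simp add: d_def w_def algebra_simps sum_subtractf sum_distrib_left)
      with c(2) show ?thesis by simp
    qed
    moreover have "\<exists>i\<in>I. d i \<noteq> 0" using c(1) I j by (auto simp: d_def)
    ultimately show ?thesis by blast
  qed
qed

lemma sum_fun_apply: "(\<Sum>i\<in>I. f i) X = (\<Sum>i\<in>I. f i X)"
  for f :: "'i \<Rightarrow> 'a \<Rightarrow> 'b::comm_monoid_add"
  by (induction I rule: infinite_finite_induct) auto

lemma card_le_of_independent_board_funs:
  assumes "finite S" "finite B" "B \<subseteq> board_funs S" "int_fun.independent B"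
  shows "card B \<le> card S"
proof (rule ccontr)
  assume "\<not> card B \<le> card S"
  then obtain c where c: "\<exists>f\<in>B. c f \<noteq> 0" "\<And>X. (\<Sum>f\<in>B. c f * f X) = 0"
    using ex_int_relation_of_card_less[of S B "\<lambda>f. f"] assms by (force simp: board_funs_def)
  have "(\<Sum>f\<in>B. int_scale (c f) f) = 0"
    using c(2) by (auto simp: fun_eq_iff sum_fun_apply int_scale_def)
  with c(1) assms show False by (auto simp: int_fun.dependent_finite)
qed

lemma int_rank_le_card:
  assumes "finite S" "M \<subseteq> board_funs S"
  shows "int_rank M \<le> enat (card S)"
  unfolding int_rank_def using assms card_le_of_independent_board_funs[of S]
  by (intro SUP_least) auto

lemma inj_scaled_delta:
  assumes "a \<noteq> 0"
  shows "inj (\<lambda>P. int_scale a (delta P))"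
proof (rule injI)
  fix P Q assume "int_scale a (delta P) = int_scale a (delta Q)"
  then have "int_scale a (delta P) P = int_scale a (delta Q) P" by simp
  with assms show "P = Q" by (auto simp: int_scale_def delta_def split: if_splits)
qed

lemma independent_scaled_delta:
  assumes "finite S" "a \<noteq> 0"
  shows "int_fun.independent ((\<lambda>P. int_scale a (delta P)) ` S)"
proof -
  have "u (int_scale a (delta P)) = 0"
    if "P \<in> S" "(\<Sum>f\<in>(\<lambda>P. int_scale a (delta P)) ` S. int_scale (u f) f) = 0" for u P
  proof -
    have "(\<Sum>Q\<in>S. int_scale (u (int_scale a (delta Q))) (int_scale a (delta Q))) P = 0"
      using that(2) inj_scaled_delta[OF assms(2)]
      by (simp add: sum.reindex[OF inj_on_subset] o_def)
    \<comment> \<open>Evaluation at \<open>P\<close> kills every summand but the one for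
      \<open>Q = P\<close>.\<close>
    then have "(\<Sum>Q\<in>S. if P = Q then u (int_scale a (delta Q)) * a else 0) = 0"
      unfolding sum_fun_apply
      by (rule trans[rotated]) (intro sum.cong, auto simp: int_scale_def delta_def)
    with assms that(1) show ?thesis by simp
  qed
  with assms show ?thesis by (auto simp: int_fun.dependent_finite)
qed

text \<open>Rank does not see a finite index: a fixed nonzero multiple of each point function
  suffices. The factor 1 serves for all board functions, the factor 2 for the span of the
  moves.\<close>

lemma int_rank_eq_card_of_scaled_delta:
  assumes "finite S" "a \<noteq> 0" "M \<subseteq> board_funs S" "\<And>P. P \<in> S \<Longrightarrow> int_scale a (delta P) \<in> M"
  shows "int_rank M = enat (card S)"
proof (rule antisym)
  let ?B = "(\<lambda>P. int_scale a (delta P)) ` S"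
  have "enat (card ?B) \<le> int_rank M"
    unfolding int_rank_def using assms independent_scaled_delta by (intro SUP_upper) auto
  then show "enat (card S) \<le> int_rank M"
    using inj_scaled_delta[OF assms(2)] by (simp add: card_image inj_on_subset)
qed (use assms int_rank_le_card in blast)

text \<open>A finite supremum bounds the cardinalities, so they form a finite nonempty set and the
  supremum is a maximum.\<close>

lemma int_rank_attained:
  assumes "int_rank M = enat n"
  obtains B where "B \<subseteq> M" "finite B" "int_fun.independent B" "card B = n"
proof -
  let ?A = "{B. B \<subseteq> M \<and> finite B \<and> int_fun.independent B}"
  let ?E = "(\<lambda>B. enat (card B)) ` ?A"
  have ne: "?E \<noteq> {}" using int_fun.independent_empty by blast
  have "x \<le> enat n" if "x \<in> ?E" for x
    using that assms unfolding int_rank_def by (metis (no_types, lifting) Sup_upper)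
  then have "finite ?E" by (intro finite_enat_bounded) auto
  \<comment> \<open>On \<open>enat\<close>, \<open>Sup\<close> is defined as \<open>Max\<close> for
    finite nonempty sets.\<close>
  then have "Sup ?E \<in> ?E" using ne Max_in[of ?E] unfolding Sup_enat_def by presburger
  then show ?thesis using assms that unfolding int_rank_def by auto
qed

lemma subspace_board_funs: "int_fun.subspace (board_funs S)"
  by (auto simp: int_fun.subspace_def board_funs_def int_scale_def)

lemma move_span_subset_board_funs: "move_span S \<subseteq> board_funs S"
  unfolding move_span_def
  by (rule int_fun.span_minimal[OF _ subspace_board_funs])
    (auto simp: moves_def board_funs_def delta_def move_triple_def)

text \<open>The set \<open>directions\<close> is closed under negation.\<close>

lemma move_triple_sym: "move_triple S P Q R \<Longrightarrow> move_triple S R Q P"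
  by (cases P; cases Q; cases R) (force simp: move_triple_def directions_def)

lemma move_in_span: "move_triple S P Q R \<Longrightarrow> delta P + delta Q - delta R \<in> move_span S"
  unfolding move_span_def moves_def by (intro int_fun.span_base) blast

lemma twice_middle_in_span:
  assumes "move_triple S P Q R"
  shows "int_scale 2 (delta Q) \<in> move_span S"
proof -
  have "int_scale 2 (delta Q) = (delta P + delta Q - delta R) + (delta R + delta Q - delta P)"
    by (auto simp: fun_eq_iff int_scale_def)
  then show ?thesis
    using move_in_span[OF assms] move_in_span[OF move_triple_sym[OF assms]]
    by (metis move_span_def int_fun.span_add)
qed

lemma twice_neighbor_in_span:
  assumes "neighbors S P R" "int_scale 2 (delta R) \<in> move_span S"
  shows "int_scale 2 (delta P) \<in> move_span S"
proof -
  obtain Q where Q: "move_triple S P Q R" using assms by (auto simp: neighbors_def)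
  have "int_scale 2 (delta P) =
      int_scale 2 (delta P + delta Q - delta R) - int_scale 2 (delta Q) + int_scale 2 (delta R)"
    by (auto simp: fun_eq_iff int_scale_def)
  then show ?thesis
    using assms(2) move_in_span[OF Q] twice_middle_in_span[OF Q]
    by (metis move_span_def int_fun.span_add int_fun.span_diff int_fun.span_scale)
qed

text \<open>Membership starts at the middle point \<open>Q\<close> and travels backwards along the
  chain of neighbors to \<open>P\<close>.\<close>

lemma twice_delta_in_span:
  assumes "move_triple S A Q B" "board_equiv S P Q"
  shows "int_scale 2 (delta P) \<in> move_span S"
  using assms(2) unfolding board_equiv_def
  by (induction rule: converse_rtranclp_induct)
    (auto intro: twice_middle_in_span[OF assms(1)] twice_neighbor_in_span)

text \<open>The class sum is linear, so only moves matter. The extremities of a move lie both inside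
  or both outside the class and carry opposite signs; the middle point lies outside.\<close>

lemma class_sum_eq_0_on_span:
  assumes "finite S" "\<forall>A Q B. move_triple S A Q B \<longrightarrow> \<not> board_equiv S P Q"
    and "f \<in> move_span S"
  shows "(\<Sum>X\<in>{X\<in>S. board_equiv S P X}. f X) = 0"
proof -
  let ?C = "{X\<in>S. board_equiv S P X}"
  have "int_fun.subspace {f. sum f ?C = 0}"
    by (auto simp: int_fun.subspace_def int_scale_def sum.distrib simp flip: sum_distrib_left)
  moreover have "sum f ?C = 0" if f: "f \<in> moves S" for f
  proof -
    obtain A Q B where AQB: "f = delta A + delta Q - delta B" "move_triple S A Q B"
      using f by (auto simp: moves_def)
    \<comment> \<open>Both orders are needed: \<open>board_equiv\<close> is only a
      reflexive-transitive closure, and its symmetry comes from reversing moves.\<close>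
    have "neighbors S A B" "neighbors S B A"
      using AQB(2) move_triple_sym[OF AQB(2)] unfolding neighbors_def by blast+
    then have "board_equiv S P A \<longleftrightarrow> board_equiv S P B"
      unfolding board_equiv_def by (blast intro: rtranclp.rtrancl_into_rtrancl)
    moreover have "A \<in> S" "B \<in> S" using AQB(2) unfolding move_triple_def by blast+
    ultimately have "A \<in> ?C \<longleftrightarrow> B \<in> ?C" by blast
    moreover have "Q \<notin> ?C" using assms(2) AQB(2) by blast
    moreover have "sum (delta Y) ?C = (if Y \<in> ?C then 1 else 0)" for Y
      using assms(1) by (simp add: delta_def sum.delta)
    ultimately show ?thesis
      unfolding AQB(1) by (simp add: sum.distrib sum_subtractf)
  qed
  ultimately have "move_span S \<subseteq> {f. sum f ?C = 0}"
    unfolding move_span_def by (intro int_fun.span_minimal) auto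
  with assms(3) show ?thesis by auto
qed

text \<open>The class sum is 0 on \<open>B\<close> and 1 on \<open>delta P\<close>, so
  \<open>delta P\<close> enlarges \<open>B\<close> to an independent set of board functions, whose
  size is at most \<open>card S\<close>.\<close>

lemma card_less_of_independent_span:
  assumes S: "finite S" and P: "P \<in> S"
    and iso: "\<forall>A Q B. move_triple S A Q B \<longrightarrow> \<not> board_equiv S P Q"
    and B: "B \<subseteq> move_span S" "finite B" "int_fun.independent B"
  shows "card B < card S"
proof -
  let ?C = "{X\<in>S. board_equiv S P X}"
  have B0: "sum f ?C = 0" if "f \<in> B" for f
    using class_sum_eq_0_on_span[OF S iso] B(1) that by blast
  have "P \<in> ?C" using P by (simp add: board_equiv_def)
  then have P1: "sum (delta P) ?C = 1" using S by (simp add: delta_def sum.delta)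
  have notin: "delta P \<notin> B" using B0 P1 by fastforce
  have "u f = 0" if f: "f \<in> insert (delta P) B"
    and 0: "(\<Sum>f\<in>insert (delta P) B. int_scale (u f) f) = 0" for u f
  proof -
    have eq: "int_scale (u (delta P)) (delta P) + (\<Sum>f\<in>B. int_scale (u f) f) = 0"
      using 0 notin B(2) by simp
    have "sum (\<Sum>f\<in>B. int_scale (u f) f) ?C = (\<Sum>f\<in>B. u f * sum f ?C)"
      unfolding sum_fun_apply by (subst sum.swap) (simp add: int_scale_def sum_distrib_left)
    also have "\<dots> = 0" using B0 by simp
    \<comment> \<open>Applying the class sum to the relation isolates the coefficient of
      \<open>delta P\<close>; what remains is a relation within \<open>B\<close>.\<close>
    finally have "u (delta P) * sum (delta P) ?C
        = sum (int_scale (u (delta P)) (delta P) + (\<Sum>f\<in>B. int_scale (u f) f)) ?C"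
      by (simp add: sum.distrib int_scale_def sum_distrib_left)
    then have uP: "u (delta P) = 0" using P1 eq by simp
    moreover have "(\<Sum>f\<in>B. int_scale (u f) f) = 0" using eq uP by simp
    then have "\<forall>f\<in>B. u f = 0" using B by (auto simp: int_fun.dependent_finite)
    ultimately show ?thesis using f by blast
  qed
  then have "int_fun.independent (insert (delta P) B)"
    using B(2) by (subst int_fun.dependent_finite) (simp, blast)
  moreover have "delta P \<in> board_funs S" using P by (auto simp: board_funs_def delta_def)
  then have "insert (delta P) B \<subseteq> board_funs S"
    using B(1) move_span_subset_board_funs by blast
  ultimately have "card (insert (delta P) B) \<le> card S"
    using card_le_of_independent_board_funs[OF S, of "insert (delta P) B"] B(2) by simp
  then show ?thesis using notin B(2) by simp
qed

theorem theorem3: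
  fixes S :: "point set"
  assumes "finite S"
  shows "(no_isolated_point S \<longleftrightarrow> int_rank (move_span S) = enat (card S))
         \<and> int_rank (board_funs S) = enat (card S)"
proof (intro conjI iffI)
  show "int_rank (board_funs S) = enat (card S)"
    by (rule int_rank_eq_card_of_scaled_delta[OF assms, of 1])
      (auto simp: board_funs_def int_scale_def delta_def)
next
  assume "no_isolated_point S"
  then show "int_rank (move_span S) = enat (card S)"
    using move_span_subset_board_funs twice_delta_in_span
    by (intro int_rank_eq_card_of_scaled_delta[OF assms, of 2])
      (auto simp: no_isolated_point_def)
next
  assume "int_rank (move_span S) = enat (card S)"
  then obtain B where B: "B \<subseteq> move_span S" "finite B" "int_fun.independent B" "card B = card S"
    by (rule int_rank_attained)
  show "no_isolated_point S"
  proof (rule ccontr)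
    assume "\<not> no_isolated_point S"
    then obtain P where "P \<in> S" "\<forall>A Q B. move_triple S A Q B \<longrightarrow> \<not> board_equiv S P Q"
      unfolding no_isolated_point_def by blast
    from card_less_of_independent_span[OF assms this B(1-3)] B(4) show False by simp
  qed
qed

end
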